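(* Under the assumptions below, if $\sigma_b \neq 0$ then \[ W_{\mathrm{out}} W_{\mathrm{in}} = U \Big(I_{m} - s^{-1} \big(I_m - B_1^{\dagger} B_1\big) B_2^\top B_2 \Big) B_1^{\dagger}, \qquad s = B_2 \big(I - B_1^{\dagger} B_1\big) B_2^\top \in \mathbb{R}. \] If $\sigma_b = 0$ then instead \[ W_{\mathrm{out}} W_{\mathrm{in}} = U B_1^{\dagger}. \]
   Context: Consider the untrained linear diagonal continuous-time reservoir $\dot{r}(t) = (-1 + \omega) r(t) + W_{\mathrm{in}} u(t) + \sigma_b \mathbf{1}_n$, with reservoir state $r(t)\in\mathbb{R}^n$, input $u(t)\in\mathbb{R}^d$, input matrix $W_{\mathrm{in}}\in\mathbb{R}^{n\times d}$, scalars $\omega<1$ and $\sigma_b\in\mathbb{R}$, and $\mathbf{1}_n$ the all-ones vector. The reservoir is driven by a training input $u$ on $[0,T]$ from $r(0)=0$, and snapshots are collected at equally spaced times $t_1,\dots,t_m\in[0,T]$ (spacing $h$) into $U=[u(t_1)\cdots u(t_m)]\in\mathbb{R}^{d\times m}$ and $R=[r(t_1)\cdots r(t_m)]\in\mathbb{R}^{n\times m}$ ($R$ assumed full row rank). The readout is obtained by least squares, $W_{\mathrm{out}} = U R^{\top}(RR^{\top})^{-1} = U R^{\dagger}$ ($\dagger$ is the Moore–Penrose pseudoinverse), and the trained closed-loop system is $\dot r = ((-1+\omega)I + W_{\mathrm{in}}W_{\mathrm{out}}) r + \sigma_b \mathbf{1}_n$. By the variation of constants formula, $r(t_i) = W_{\mathrm{in}}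 b_1(t_i) + b_2(t_i)\mathbf{1}_n$ with $b_1(t_i) = \int_0^{t_i} e^{(\omega-1)(t_i-\tau)}u(\tau)\,d\tau \in\mathbb{R}^d$ and $b_2(t_i) = \sigma_b\big(e^{(\omega-1)t_i}-1\big)/(\omega-1)\in\mathbb{R}$; define $B_1 = [b_1(t_1)\cdots b_1(t_m)]$ and $B_2 = [b_2(t_1)\cdots b_2(t_m)]$. Data informativity assumption: (1) $u\in L^2([0,T];\mathbb{R}^d)$; (2) if $\sigma_b=0$, then $m\ge d$ and the components $u_1,\dots,u_d$ are linearly independent in $L^2([0,T];\mathbb{R})$; (3) if $\sigma_b\neq 0$, then $m\ge d+1$ and $u_1,\dots,u_d$ together with the constant function $1$ are linearly independent in $L^2([0,T];\mathbb{R})$. The sample times are assumed to lie outside the Lebesgue-measure-zero set on which the rows of $B_1$ and $B_2$ fail to be mutually linearly independent. Further assume $W_{\mathrm{in}}$ has full column rank $d$ and $\mathbf{1}_n\notin \operatorname{Im} W_{\mathrm{in}}$. *)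

theory Defs
  imports "HOL-Analysis.Analysis"
begin

text \<open>Moore--Penrose pseudoinverse, defined by the four Penrose conditions.\<close>
definition pinv :: "real^'m^'n \<Rightarrow> real^'n^'m" where
  "pinv A = (THE X. A ** X ** A = A \<and> X ** A ** X = X \<and>
                    transpose (A ** X) = A ** X \<and> transpose (X ** A) = X ** A)"

text \<open>All-ones vector.\<close>
definition ones :: "real^'n" where "ones = (\<chi> i. 1)"

text \<open>Reservoir state of r' = (-1+omega) r + W_in u + sigma_b 1, r(0)=0,
  given by the variation of constants formula (mild solution).\<close>
definition reservoir_state ::
  "real \<Rightarrow> real^'d^'n \<Rightarrow> real \<Rightarrow> (real \<Rightarrow> real^'d) \<Rightarrow> real \<Rightarrow> real^'n" where
  "reservoir_state omega Win sigma_b u t =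
     integral {0..t} (\<lambda>\<tau>. exp ((omega - 1) * (t - \<tau>)) *\<^sub>R (Win *v u \<tau> + sigma_b *\<^sub>R ones))"

definition b1 :: "real \<Rightarrow> (real \<Rightarrow> real^'d) \<Rightarrow> real \<Rightarrow> real^'d" where
  "b1 omega u t = integral {0..t} (\<lambda>\<tau>. exp ((omega - 1) * (t - \<tau>)) *\<^sub>R u \<tau>)"

definition b2 :: "real \<Rightarrow> real \<Rightarrow> real \<Rightarrow> real" where
  "b2 omega sigma_b t = sigma_b * (exp ((omega - 1) * t) - 1) / (omega - 1)"

text \<open>Snapshot matrices (columns indexed by sample index).\<close>
definition snap_U :: "(real \<Rightarrow> real^'d) \<Rightarrow> ('m \<Rightarrow> real) \<Rightarrow> real^'m^'d" where
  "snap_U u ts = (\<chi> k i. u (ts i) $ k)"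

definition snap_R :: "real \<Rightarrow> real^'d^'n \<Rightarrow> real \<Rightarrow> (real \<Rightarrow> real^'d) \<Rightarrow> ('m \<Rightarrow> real) \<Rightarrow> real^'m^'n" where
  "snap_R omega Win sigma_b u ts = (\<chi> j i. reservoir_state omega Win sigma_b u (ts i) $ j)"

definition snap_B1 :: "real \<Rightarrow> (real \<Rightarrow> real^'d) \<Rightarrow> ('m \<Rightarrow> real) \<Rightarrow> real^'m^'d" where
  "snap_B1 omega u ts = (\<chi> k i. b1 omega u (ts i) $ k)"

definition snap_B2 :: "real \<Rightarrow> real \<Rightarrow> ('m \<Rightarrow> real) \<Rightarrow> real^'m" where
  "snap_B2 omega sigma_b ts = (\<chi> i. b2 omega sigma_b (ts i))"

text \<open>Least-squares readout W_out = U R^T (R R^T)^{-1}.\<close>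
definition W_out :: "real^'m^'d \<Rightarrow> real^'m^'n \<Rightarrow> real^'n^'d" where
  "W_out U R = U ** transpose R ** matrix_inv (R ** transpose R)"

text \<open>Outer product x^T y of row vectors (an m x m matrix).\<close>
definition outer :: "real^'m \<Rightarrow> real^'m \<Rightarrow> real^'m^'m" where
  "outer x y = (\<chi> i j. x $ i * y $ j)"

end

(* By variation of constants, R = Win B1 + 1 B2, and (c, c0) -> Win c + c0 1 is injective. For R
   of full row rank, pinv R Win is the unique solution X of R X = Win whose columns are
   orthogonal to ker R, and ker R = ker B1 \<inter> ker B2. So it suffices to exhibit X with B1 X = I,
   B2 X = 0 and columns orthogonal to ker B1 \<inter> ker B2. For sigma_b = 0 this is pinv B1; otherwise it
   is the first block of the pseudoinverse of the stacked matrix [B1; B2], obtained from pinv B1 by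
   a rank-one correction along the component of B2 orthogonal to the row space of B1. *)

theory Submission
  imports Defs
begin

lemma matrix_inv_right:
  fixes M :: "'a::semiring_1^'n^'n"
  assumes "invertible M"
  shows "M ** matrix_inv M = mat 1"
  using someI_ex[OF assms[unfolded invertible_def]] unfolding matrix_inv_def by auto

lemma symmetric_matrix_inv:
  fixes M :: "'a::comm_semiring_1^'n^'n"
  assumes "invertible M" and "transpose M = M"
  shows "transpose (matrix_inv M) = matrix_inv M"
proof -
  let ?K = "matrix_inv M"
  have KM: "transpose ?K ** M = mat 1"
    using arg_cong[OF matrix_inv_right[OF assms(1)], of transpose] assms(2)
    by (simp add: matrix_transpose_mul)
  have "transpose ?K = (transpose ?K ** M) ** ?K"
    using matrix_inv_right[OF assms(1)] by (metis matrix_mul_assoc matrix_mul_rid)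
  then show ?thesis using KM by simp
qed

lemma transpose_diff: "transpose (A - B) = transpose A - transpose (B :: 'a::ab_group_add^'n^'m)"
  by (simp add: transpose_def vec_eq_iff)

lemma invertible_mult_transpose:
  fixes A :: "real^'m^'n"
  assumes "\<forall>c. c v* A = 0 \<longrightarrow> c = 0"
  shows "invertible (A ** transpose A)"
proof -
  have "x = 0" if "(A ** transpose A) *v x = 0" for x
  proof -
    have "(x v* A) \<bullet> (x v* A) = x \<bullet> (A *v (transpose A *v x))"
      by (simp only: dot_lmul_matrix transpose_matrix_vector)
    also have "\<dots> = x \<bullet> ((A ** transpose A) *v x)"
      by (simp only: matrix_vector_mul_assoc)
    finally have "(x v* A) \<bullet> (x v* A) = x \<bullet> ((A ** transpose A) *v x)" .
    then have "x v* A = 0" using that by simp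
    then show "x = 0" using assms by blast
  qed
  then show ?thesis
    using matrix_left_invertible_ker invertible_left_inverse by blast
qed

lemma full_row_rank_independent_rows:
  fixes A :: "real^'m^'n"
  assumes "rank A = CARD('n)" and "c v* A = 0"
  shows "c = 0"
proof -
  have "rank (transpose A) = CARD('n)" using assms(1) by (simp only: rank_transpose)
  then have "inj ((*v) (transpose A))" by (simp only: full_rank_injective)
  moreover have "transpose A *v c = transpose A *v 0" using assms(2) by simp
  ultimately show ?thesis by (rule injD)
qed

lemma pinv_eqI:
  fixes A :: "real^'m^'n" and X :: "real^'n^'m"
  assumes p1: "A ** X ** A = A" and p2: "X ** A ** X = X"
    and p3: "transpose (A ** X) = A ** X" and p4: "transpose (X ** A) = X ** A"
  shows "pinv A = X"
  unfolding pinv_def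
proof (rule the_equality)
  show "A ** X ** A = A \<and> X ** A ** X = X \<and> transpose (A ** X) = A ** X \<and> transpose (X ** A) = X ** A"
    using assms by blast
next
  fix Y assume "A ** Y ** A = A \<and> Y ** A ** Y = Y \<and> transpose (A ** Y) = A ** Y \<and> transpose (Y ** A) = Y ** A"
  then have q1: "A ** Y ** A = A" and q2: "Y ** A ** Y = Y"
    and q3: "transpose (A ** Y) = A ** Y" and q4: "transpose (Y ** A) = Y ** A" by auto
  have "Y = Y ** transpose (A ** Y)" using q2 q3 by (simp add: matrix_mul_assoc)
  also have "\<dots> = Y ** transpose (A ** Y) ** transpose (A ** X)" using p1
    by (metis matrix_mul_assoc matrix_transpose_mul)
  also have "\<dots> = Y ** A ** X" using q2 q3 p3 by (simp add: matrix_mul_assoc)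
  finally have y: "Y = Y ** A ** X" .
  have "X = transpose (X ** A) ** X" using p2 p4 by (simp add: matrix_mul_assoc)
  also have "\<dots> = transpose (Y ** A) ** transpose (X ** A) ** X" using q1
    by (metis matrix_mul_assoc matrix_transpose_mul)
  also have "\<dots> = Y ** A ** (X ** A ** X)" using q4 p4 by (simp add: matrix_mul_assoc)
  also have "\<dots> = Y ** A ** X" using p2 by simp
  finally show "Y = X" using y by simp
qed

lemma outer_mult_vector: "outer x y *v z = (y \<bullet> z) *\<^sub>R x"
  by (simp add: vec_eq_iff matrix_vector_mult_def outer_def inner_vec_def sum_distrib_left mult_ac)

lemma vector_mult_outer: "z v* outer x y = (z \<bullet> x) *\<^sub>R y"
  unfolding vec_eq_iff vector_matrix_mult_def outer_def inner_vec_def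
  by (simp add: sum_distrib_right mult.assoc)

definition ker_projection :: "real^'m^'n \<Rightarrow> real^'m^'m" where
  "ker_projection A = mat 1 - pinv A ** A"

context
  fixes A :: "real^'m^'n"
  assumes gram: "invertible (A ** transpose A)"
begin

lemma pinv_full_row_rank: "pinv A = transpose A ** matrix_inv (A ** transpose A)"
proof -
  let ?K = "matrix_inv (A ** transpose A)"
  have Ks: "transpose ?K = ?K"
    using symmetric_matrix_inv[OF gram] by (simp add: matrix_transpose_mul)
  have AX: "A ** (transpose A ** ?K) = mat 1"
    using matrix_inv_right[OF gram] by (simp add: matrix_mul_assoc)
  show ?thesis
  proof (rule pinv_eqI)
    show "A ** (transpose A ** ?K) ** A = A" using AX by simp
    show "transpose A ** ?K ** A ** (transpose A ** ?K) = transpose A ** ?K"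
      using AX by (metis matrix_mul_assoc matrix_mul_rid)
    show "transpose (A ** (transpose A ** ?K)) = A ** (transpose A ** ?K)" using AX by simp
    show "transpose (transpose A ** ?K ** A) = transpose A ** ?K ** A"
      using Ks by (simp add: matrix_transpose_mul matrix_mul_assoc)
  qed
qed

lemma right_inverse_pinv: "A ** pinv A = mat 1"
  using matrix_inv_right[OF gram] by (simp add: pinv_full_row_rank matrix_mul_assoc)

lemma pinv_mult_vector_in_row_space: "pinv A *v y = (matrix_inv (A ** transpose A) *v y) v* A"
  by (simp add: pinv_full_row_rank matrix_vector_mul_assoc[symmetric])

lemma vector_pinv_eq_0: "A *v v = 0 \<Longrightarrow> v v* pinv A = 0"
  by (simp add: pinv_full_row_rank vector_matrix_mul_assoc[symmetric])

lemma symmetric_pinv_mult: "transpose (pinv A ** A) = pinv A ** A"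
  using symmetric_matrix_inv[OF gram]
  by (simp add: pinv_full_row_rank matrix_transpose_mul matrix_mul_assoc)

text \<open>The kernel condition says that the columns of X lie in the row space of A.\<close>

lemma pinv_mult_eqI:
  assumes AX: "A ** X = B" and ker: "\<And>v. A *v v = 0 \<Longrightarrow> v v* X = 0"
  shows "pinv A ** B = X"
  unfolding matrix_eq
proof
  fix z
  define x where "x = X *v z"
  define y where "y = x - pinv A *v (A *v x)"
  have "A *v y = A *v x - (A ** pinv A) *v (A *v x)"
    by (simp add: y_def matrix_vector_mult_diff_distrib matrix_vector_mul_assoc matrix_mul_assoc)
  then have Ay: "A *v y = 0" by (simp add: right_inverse_pinv)
  have "x \<bullet> y = z \<bullet> (y v* X)"
    by (metis x_def dot_lmul_matrix inner_commute transpose_matrix_vector)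
  then have xy: "x \<bullet> y = 0" using ker[OF Ay] by simp
  have "(pinv A *v (A *v x)) \<bullet> y = x \<bullet> ((pinv A ** A) *v y)"
    by (metis symmetric_pinv_mult dot_lmul_matrix matrix_vector_mul_assoc transpose_matrix_vector)
  then have "(pinv A *v (A *v x)) \<bullet> y = 0"
    using Ay by (simp add: matrix_vector_mul_assoc[symmetric])
  then have "y \<bullet> y = 0"
    using xy by (simp add: y_def inner_diff_left)
  then have "x = pinv A *v (A *v x)" by (simp add: y_def)
  then show "(pinv A ** B) *v z = X *v z"
    by (simp add: x_def AX[symmetric] matrix_vector_mul_assoc matrix_mul_assoc)
qed

lemma W_out_eq_pinv: "W_out U A = U ** pinv A"
  by (simp add: W_out_def pinv_full_row_rank matrix_mul_assoc)

lemma ker_projection_apply: "ker_projection A *v w = w - pinv A *v (A *v w)"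
  by (simp add: ker_projection_def matrix_vector_mult_diff_rdistrib matrix_vector_mul_assoc)

lemma ker_projection_in_kernel: "A *v (ker_projection A *v w) = 0"
  by (simp add: ker_projection_apply matrix_vector_mult_diff_distrib matrix_vector_mul_assoc
      right_inverse_pinv matrix_mul_assoc)

lemma ker_projection_fixes_kernel: "A *v v = 0 \<Longrightarrow> ker_projection A *v v = v"
  by (simp add: ker_projection_apply)

lemma symmetric_ker_projection: "transpose (ker_projection A) = ker_projection A"
  by (simp add: ker_projection_def transpose_diff symmetric_pinv_mult)

end

text \<open>As P is a symmetric idempotent, b \<bullet> P b = |P b|^2, and P b = 0 would put b in the row
  space of B.\<close>

lemma inner_ker_projection_nonzero:
  fixes B :: "real^'m^'d" and b :: "real^'m"
  assumes indep: "\<forall>c c0. c v* B + c0 *\<^sub>R b = 0 \<longrightarrow> c = 0 \<and> c0 = 0"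
  shows "b \<bullet> (ker_projection B *v b) \<noteq> 0"
proof
  let ?P = "ker_projection B"
  have gram: "invertible (B ** transpose B)"
    using indep[rule_format, of _ 0] by (intro invertible_mult_transpose) simp
  assume "b \<bullet> (?P *v b) = 0"
  moreover have "b \<bullet> (?P *v b) = (?P *v b) \<bullet> (?P *v b)"
    using ker_projection_fixes_kernel[OF gram ker_projection_in_kernel[OF gram], of b]
      dot_lmul_matrix[of b ?P "?P *v b"] symmetric_ker_projection[OF gram]
    by (metis transpose_matrix_vector)
  ultimately have "?P *v b = 0" by simp
  then have "b = (matrix_inv (B ** transpose B) *v (B *v b)) v* B"
    using ker_projection_apply[OF gram, of b] pinv_mult_vector_in_row_space[OF gram] by simp
  then have "(matrix_inv (B ** transpose B) *v (B *v b)) v* B + (-1) *\<^sub>R b = 0" by simp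
  then show False using indep[rule_format, of _ "-1"] by simp
qed

text \<open>X is the left d-column block of the pseudoinverse of the stacked matrix [B; b]: the
  rank-one term corrects pinv B so that b \<bullet> X z = 0.\<close>

lemma rank_one_corrected_pinv:
  fixes B :: "real^'m^'d" and b :: "real^'m"
  assumes indep: "\<forall>c c0. c v* B + c0 *\<^sub>R b = 0 \<longrightarrow> c = 0 \<and> c0 = 0"
  defines "X \<equiv> (mat 1 - inverse (b \<bullet> (ker_projection B *v b)) *\<^sub>R (ker_projection B ** outer b b))
                ** pinv B"
  shows "B ** X = mat 1" and "b v* X = 0" and "B *v v = 0 \<Longrightarrow> b \<bullet> v = 0 \<Longrightarrow> v v* X = 0"
proof -
  let ?P = "ker_projection B"
  let ?s = "b \<bullet> (?P *v b)"
  have gram: "invertible (B ** transpose B)"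
    using indep[rule_format, of _ 0] by (intro invertible_mult_transpose) simp
  have Xv: "X *v z = pinv B *v z - (inverse ?s * (b \<bullet> (pinv B *v z))) *\<^sub>R (?P *v b)" for z
    unfolding X_def
    by (simp add: matrix_vector_mul_assoc[symmetric] matrix_vector_mult_diff_rdistrib
        scaleR_matrix_vector_assoc[symmetric] outer_mult_vector matrix_vector_mult_scaleR)
  have "B *v (pinv B *v z) = z" for z
    using right_inverse_pinv[OF gram] by (simp add: matrix_vector_mul_assoc)
  then show "B ** X = mat 1"
    unfolding matrix_eq
    by (simp add: Xv matrix_vector_mul_assoc[symmetric] matrix_vector_mult_diff_distrib
        matrix_vector_mult_scaleR ker_projection_in_kernel[OF gram])
  have "b \<bullet> (X *v z) = 0" for z
    using inner_ker_projection_nonzero[OF indep] by (simp add: Xv inner_diff_right)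
  then have "(b v* X) \<bullet> (b v* X) = 0" by (simp only: dot_lmul_matrix)
  then show "b v* X = 0" by simp
  assume Bv: "B *v v = 0" and bv: "b \<bullet> v = 0"
  have "v v* ?P = v"
    using ker_projection_fixes_kernel[OF gram Bv] symmetric_ker_projection[OF gram]
    by (metis transpose_matrix_vector)
  then have "v v* (mat 1 - inverse ?s *\<^sub>R (?P ** outer b b)) = v"
    by (simp add: vector_matrix_mult_diff_rdistrib vector_scaleR_matrix_ac
        vector_matrix_mul_assoc[symmetric] vector_mult_outer inner_commute bv)
  then show "v v* X = 0"
    unfolding X_def using vector_pinv_eq_0[OF gram Bv] by (simp add: vector_matrix_mul_assoc[symmetric])
qed

lemma independent_columns_append:
  fixes W :: "real^'d^'n"
  assumes rank: "rank W = CARD('d)" and e: "e \<notin> range ((*v) W)"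
    and dep: "W *v c + c0 *\<^sub>R e = 0"
  shows "c = 0 \<and> c0 = 0"
proof -
  have "c0 = 0"
  proof (rule ccontr)
    assume "c0 \<noteq> 0"
    have "W *v ((- inverse c0) *\<^sub>R c) = (- inverse c0) *\<^sub>R (W *v c)"
      by (rule matrix_vector_mult_scaleR)
    also have "\<dots> = e"
      using dep \<open>c0 \<noteq> 0\<close> by (simp add: eq_neg_iff_add_eq_0[symmetric])
    finally have "e = W *v ((- inverse c0) *\<^sub>R c)" by simp
    then show False using e by auto
  qed
  moreover have "inj ((*v) W)" using rank by (simp only: full_rank_injective)
  ultimately show ?thesis
    using dep by (metis add.right_neutral matrix_vector_mult_0_right scale_zero_left injD)
qed

lemma pinv_reservoir_mult_eqI:
  fixes Win :: "real^'d^'n" and B1 :: "real^'m^'d" and B2 :: "real^'m" and X :: "real^'d^'m"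
  assumes gram: "invertible (R ** transpose R)"
    and R: "R = Win ** B1 + (\<chi> j i. B2 $ i)"
    and Win_rank: "rank Win = CARD('d)" and ones_notin: "ones \<notin> range ((*v) Win)"
    and B1X: "B1 ** X = mat 1" and B2X: "B2 v* X = 0"
    and ker: "\<And>v. B1 *v v = 0 \<Longrightarrow> B2 \<bullet> v = 0 \<Longrightarrow> v v* X = 0"
  shows "pinv R ** Win = X"
proof (rule pinv_mult_eqI[OF gram])
  have ones_row: "(\<chi> j i. B2 $ i) *v w = (B2 \<bullet> w) *\<^sub>R (ones :: real^'n)" for w
    unfolding vec_eq_iff matrix_vector_mult_def inner_vec_def ones_def by (simp add: mult.commute)
  have Rv: "R *v w = Win *v (B1 *v w) + (B2 \<bullet> w) *\<^sub>R ones" for w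
    unfolding R matrix_vector_mult_add_rdistrib ones_row by (simp add: matrix_vector_mul_assoc)
  have "B1 *v (X *v z) = z" for z
    using B1X by (simp add: matrix_vector_mul_assoc)
  moreover have "B2 \<bullet> (X *v z) = 0" for z
    using B2X dot_lmul_matrix[of B2 X z] by simp
  ultimately show "R ** X = Win"
    unfolding matrix_eq by (simp add: Rv matrix_vector_mul_assoc[symmetric])
  fix v assume "R *v v = 0"
  then have "B1 *v v = 0 \<and> B2 \<bullet> v = 0"
    using independent_columns_append[OF Win_rank ones_notin] by (simp add: Rv)
  then show "v v* X = 0" using ker by simp
qed

lemma square_integrable_imp_absolutely_integrable:
  fixes f :: "real \<Rightarrow> 'b::euclidean_space"
  assumes "f measurable_on {a..b}" and "(\<lambda>t. (norm (f t))\<^sup>2) integrable_on {a..b}"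
  shows "f absolutely_integrable_on {a..b}"
proof (rule measurable_bounded_by_integrable_imp_absolutely_integrable)
  show "f \<in> borel_measurable (lebesgue_on {a..b})"
    by (rule measurable_on_imp_borel_measurable_lebesgue[OF assms(1)]) simp
  show "(\<lambda>t. 1 + (norm (f t))\<^sup>2) integrable_on {a..b}"
    by (rule integrable_add[OF _ assms(2)]) auto
  show "norm (f x) \<le> 1 + (norm (f x))\<^sup>2" for x
    using zero_le_power2[of "norm (f x) - 1"]
    by (simp add: power2_diff) (smt (verit) zero_le_power2)
qed simp

lemma absolutely_integrable_continuous_scaleR:
  fixes f :: "real \<Rightarrow> 'b::euclidean_space"
  assumes g: "continuous_on {a..b} g" and f: "f absolutely_integrable_on {a..b}"
  shows "(\<lambda>x. g x *\<^sub>R f x) absolutely_integrable_on {a..b}"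
proof (rule absolutely_integrable_bounded_measurable_product[OF
    bilinear_conv_bounded_bilinear[THEN iffD2, OF bounded_bilinear_scaleR] _ _ _ f])
  show "g \<in> borel_measurable (lebesgue_on {a..b})"
    by (rule continuous_imp_measurable_on_sets_lebesgue[OF g]) simp
  show "bounded (g ` {a..b})"
    by (rule compact_imp_bounded[OF compact_continuous_image[OF g]]) simp
qed simp

lemma has_integral_b2:
  assumes "omega < 1" and "0 \<le> t"
  shows "((\<lambda>\<tau>. exp ((omega - 1) * (t - \<tau>)) * sg) has_integral b2 omega sg t) {0..t}"
proof -
  define k where "k = - sg / (omega - 1)"
  define F where "F \<tau> = k * exp ((omega - 1) * (t - \<tau>))" for \<tau>
  have "(F has_real_derivative k * (exp ((omega - 1) * (t - \<tau>)) * ((omega - 1) * (0 - 1))))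
      (at \<tau> within {0..t})" for \<tau>
    unfolding F_def by (auto intro!: derivative_eq_intros)
  moreover have "k * (exp ((omega - 1) * (t - \<tau>)) * ((omega - 1) * (0 - 1)))
      = exp ((omega - 1) * (t - \<tau>)) * sg" for \<tau>
    using assms(1) by (simp add: k_def field_simps)
  ultimately have "(F has_real_derivative exp ((omega - 1) * (t - \<tau>)) * sg) (at \<tau> within {0..t})"
    for \<tau> by metis
  then have "((\<lambda>\<tau>. exp ((omega - 1) * (t - \<tau>)) * sg) has_integral F t - F 0) {0..t}"
    using assms(2)
    by (intro fundamental_theorem_of_calculus) (simp_all add: has_real_derivative_iff_has_vector_derivative)
  moreover have "F t - F 0 = b2 omega sg t"
    by (simp add: F_def k_def b2_def divide_inverse algebra_simps)
  ultimately show ?thesis by simp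
qed

lemma reservoir_state_decomposition:
  fixes u :: "real \<Rightarrow> real^'d" and Win :: "real^'d^'n"
  assumes u: "u absolutely_integrable_on {0..T}" and t: "t \<in> {0..T}" and omega: "omega < 1"
  shows "reservoir_state omega Win sg u t = Win *v b1 omega u t + b2 omega sg t *\<^sub>R ones"
proof -
  let ?e = "\<lambda>\<tau>. exp ((omega - 1) * (t - \<tau>))"
  have "u absolutely_integrable_on {0..t}"
    using absolutely_integrable_on_subinterval[OF u] t by auto
  then have int_u: "(\<lambda>\<tau>. ?e \<tau> *\<^sub>R u \<tau>) integrable_on {0..t}"
    by (intro absolutely_integrable_continuous_scaleR[THEN set_lebesgue_integral_eq_integral(1)]
        continuous_intros)
  have lin: "bounded_linear ((*v) Win)"
    by (simp add: matrix_vector_mul_bounded_linear)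
  have int_ones: "((\<lambda>\<tau>. (?e \<tau> * sg) *\<^sub>R (ones::real^'n)) has_integral b2 omega sg t *\<^sub>R ones) {0..t}"
    using t by (intro has_integral_scaleR_left has_integral_b2 omega) auto
  have "(\<lambda>\<tau>. ?e \<tau> *\<^sub>R (Win *v u \<tau> + sg *\<^sub>R ones)) =
      (\<lambda>\<tau>. ((*v) Win \<circ> (\<lambda>\<tau>. ?e \<tau> *\<^sub>R u \<tau>)) \<tau> + (?e \<tau> * sg) *\<^sub>R ones)"
    by (auto simp: o_def matrix_vector_mult_scaleR scaleR_add_right)
  then have "reservoir_state omega Win sg u t =
      integral {0..t} ((*v) Win \<circ> (\<lambda>\<tau>. ?e \<tau> *\<^sub>R u \<tau>)) + integral {0..t} (\<lambda>\<tau>. (?e \<tau> * sg) *\<^sub>R (ones::real^'n))"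
    unfolding reservoir_state_def
    using integral_add[OF integrable_linear[OF int_u lin] has_integral_integrable[OF int_ones]] by simp
  also have "\<dots> = Win *v b1 omega u t + b2 omega sg t *\<^sub>R ones"
    using integral_linear[OF int_u lin] int_ones unfolding b1_def by (simp add: has_integral_iff)
  finally show ?thesis .
qed

lemma snap_R_decomposition:
  fixes u :: "real \<Rightarrow> real^'d" and Win :: "real^'d^'n" and ts :: "'m::finite \<Rightarrow> real"
  assumes "\<forall>i. ts i \<in> {0..T}" and "u absolutely_integrable_on {0..T}" and "omega < 1"
  shows "snap_R omega Win sg u ts = Win ** snap_B1 omega u ts + (\<chi> j i. snap_B2 omega sg ts $ i)"
proof -
  have "(Win ** snap_B1 omega u ts) $ j $ i = (Win *v b1 omega u (ts i)) $ j" for i j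
    unfolding snap_B1_def matrix_matrix_mult_def matrix_vector_mult_def by simp
  moreover have "reservoir_state omega Win sg u (ts i)
      = Win *v b1 omega u (ts i) + b2 omega sg (ts i) *\<^sub>R ones" for i
    using reservoir_state_decomposition[OF assms(2) assms(1)[rule_format] assms(3)] .
  ultimately show ?thesis
    by (simp add: vec_eq_iff snap_R_def snap_B2_def ones_def)
qed

theorem lemma1:
  fixes u :: "real \<Rightarrow> real^('d::finite)"
    and Win :: "real^('d::finite)^('n::finite)"
    and ts :: "('m::finite) \<Rightarrow> real"
    and omega sigma_b T h t1 :: real
    and idx :: "'m \<Rightarrow> nat"
  defines "U \<equiv> snap_U u ts"
    and "R \<equiv> snap_R omega Win sigma_b u ts"
    and "B1 \<equiv> snap_B1 omega u ts"
    and "B2 \<equiv> snap_B2 omega sigma_b ts"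
  assumes omega: "omega < 1"
    and times_in: "\<forall>i. ts i \<in> {0..T}"
    and equispaced: "h > 0" "bij_betw idx UNIV {..<CARD('m)}" "\<forall>i. ts i = t1 + h * real (idx i)"
    and u_L2: "u measurable_on {0..T}" "(\<lambda>t. (norm (u t))\<^sup>2) integrable_on {0..T}"
    and informative0: "sigma_b = 0 \<Longrightarrow> CARD('m) \<ge> CARD('d) \<and>
           (\<forall>c::real^'d. negligible {t \<in> {0..T}. c \<bullet> u t \<noteq> 0} \<longrightarrow> c = 0)"
    and informative1: "sigma_b \<noteq> 0 \<Longrightarrow> CARD('m) \<ge> CARD('d) + 1 \<and>
           (\<forall>(c::real^'d) (c0::real). negligible {t \<in> {0..T}. c \<bullet> u t + c0 \<noteq> 0} \<longrightarrow> c = 0 \<and> c0 = 0)"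
    and generic_B1: "\<forall>c::real^'d. c v* B1 = 0 \<longrightarrow> c = 0"
    and generic_B12: "sigma_b \<noteq> 0 \<Longrightarrow>
           (\<forall>(c::real^'d) (c0::real). c v* B1 + c0 *\<^sub>R B2 = 0 \<longrightarrow> c = 0 \<and> c0 = 0)"
    and R_rank: "rank R = CARD('n)"
    and Win_rank: "rank Win = CARD('d)"
    and ones_notin: "(ones :: real^'n) \<notin> range ((*v) Win)"
  shows "(sigma_b \<noteq> 0 \<longrightarrow>
            (let s = B2 \<bullet> ((mat 1 - pinv B1 ** B1) *v B2)
             in W_out U R ** Win
                  = U ** (mat 1 - inverse s *\<^sub>R ((mat 1 - pinv B1 ** B1) ** outer B2 B2)) ** pinv B1))
       \<and> (sigma_b = 0 \<longrightarrow> W_out U R ** Win = U ** pinv B1)"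
proof -
  have R_eq: "R = Win ** B1 + (\<chi> j i. B2 $ i)"
    unfolding R_def B1_def B2_def
    using snap_R_decomposition[OF times_in square_integrable_imp_absolutely_integrable[OF u_L2] omega] .
  have gram: "invertible (R ** transpose R)"
    using full_row_rank_independent_rows[OF R_rank] by (intro invertible_mult_transpose) blast
  have readout: "W_out U R ** Win = U ** (pinv R ** Win)"
    by (simp add: W_out_eq_pinv[OF gram] matrix_mul_assoc)
  note pinv_R_mult_Win = pinv_reservoir_mult_eqI[OF gram R_eq Win_rank ones_notin]
  show ?thesis
  proof (intro conjI impI)
    assume "sigma_b \<noteq> 0"
    note corrected = rank_one_corrected_pinv[OF generic_B12[OF this]]
    show "let s = B2 \<bullet> ((mat 1 - pinv B1 ** B1) *v B2)
          in W_out U R ** Win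
               = U ** (mat 1 - inverse s *\<^sub>R ((mat 1 - pinv B1 ** B1) ** outer B2 B2)) ** pinv B1"
      using pinv_R_mult_Win[OF corrected] readout
      by (simp add: Let_def ker_projection_def matrix_mul_assoc)
  next
    assume "sigma_b = 0"
    then have "B2 = 0" by (simp add: B2_def snap_B2_def b2_def vec_eq_iff)
    moreover have "invertible (B1 ** transpose B1)"
      using generic_B1 by (rule invertible_mult_transpose)
    ultimately have "pinv R ** Win = pinv B1"
      by (intro pinv_R_mult_Win) (simp_all add: right_inverse_pinv vector_pinv_eq_0)
    then show "W_out U R ** Win = U ** pinv B1" using readout by simp
  qed
qed

end
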